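(* Let $X$ be a strongly zero-dimensional metrizable space with $|X|\le\mathfrak c$. Then, for every $d\in\operatorname{Met}(X)$ and every $\varepsilon>0$, there exists $e\in \mathrm{A}(X)$ such that $\mathcal D_X(d,e)<\varepsilon$. If $X$ is completely metrizable, then $e$ can be chosen complete (that is, in this case, for every $d\in\operatorname{Met}(X)$ and every $\varepsilon>0$ there exists a complete metric $e\in \mathrm{A}(X)$ with $\mathcal D_X(d,e)<\varepsilon$).
   Context: $\mathfrak c$ is the cardinality of the continuum. A nonempty metrizable space is strongly zero-dimensional if its covering dimension is zero, or equivalently, if its large inductive dimension is zero; the empty space is also regarded as strongly zero-dimensional. For a metrizable space $X$, $\operatorname{Met}(X)$ denotes the set of all metrics on $X$ inducing the topology of $X$ (compatible metrics). For $d,e\in\operatorname{Met}(X)$, put $\mathcal D_X(d,e)=\sup_{x,y\in X}|d(x,y)-e(x,y)|\in[0,\infty]$ (taken to be $0$ if $X$ is empty). Write $[X]^2=\{\{x,y\}\mid x,y\in X,\ x\neq y\}$. A metric $d\in\operatorname{Met}(X)$ has algebraically independent distances if, for every positive integer $r$, every choice of distinct $\{x_1,y_1\},\dots,\{x_r,y_r\}\in[X]^2$, and every nonzero polynomial $P\in\mathbb Q[T_1,\dots,T_r]$, we have $P(d(x_1,y_1),\dots,d(x_r,y_r))\neq 0$. $\mathrm{A}(X)$ denotes the set of all such metrics in $\operatorname{Met}(X)$. *)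

theory Defs
  imports "HOL-Analysis.Analysis" "HOL-Library.Poly_Mapping"
begin

text \<open>The condition \<open>dim X \<le> n\<close> for the Lebesgue covering dimension.  As the refinement covers
  \<open>X\<close>, \<open>covering_dim_le X (- 1)\<close> says that \<open>X\<close> is empty.\<close>

definition covering_dim_le :: "'a topology \<Rightarrow> int \<Rightarrow> bool" where
  "covering_dim_le X n \<longleftrightarrow>
     (\<forall>\<U>. finite \<U> \<and> (\<forall>U\<in>\<U>. openin X U) \<and> \<Union>\<U> = topspace X \<longrightarrow>
       (\<exists>\<V>. finite \<V> \<and> (\<forall>V\<in>\<V>. openin X V) \<and> \<Union>\<V> = topspace X \<and>
         (\<forall>V\<in>\<V>. \<exists>U\<in>\<U>. V \<subseteq> U) \<and>
         (\<forall>x\<in>topspace X. int (card {V\<in>\<V>. x \<in> V}) \<le> n + 1)))"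

definition has_covering_dim :: "'a topology \<Rightarrow> int \<Rightarrow> bool" where
  "has_covering_dim X n \<longleftrightarrow> covering_dim_le X n \<and> \<not> covering_dim_le X (n - 1)"

definition strongly_zero_dimensional :: "'a topology \<Rightarrow> bool" where
  "strongly_zero_dimensional X \<longleftrightarrow> topspace X = {} \<or> has_covering_dim X 0"

text \<open>A metric is a total function on the ambient type.  The locale \<open>Metric_space\<close> also asks for
  symmetry and nonnegativity off the carrier, where the values are otherwise irrelevant.\<close>

definition Met :: "'a topology \<Rightarrow> ('a \<Rightarrow> 'a \<Rightarrow> real) set" where
  "Met X = {d. Metric_space (topspace X) d \<and> Metric_space.mtopology (topspace X) d = X}"

definition sup_dist ::
  "'a topology \<Rightarrow> ('a \<Rightarrow> 'a \<Rightarrow> real) \<Rightarrow> ('a \<Rightarrow> 'a \<Rightarrow> real) \<Rightarrow> ennreal" where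
  "sup_dist X d e = (SUP (x, y) \<in> topspace X \<times> topspace X. ennreal \<bar>d x y - e x y\<bar>)"

text \<open>A polynomial with rational coefficients is a finitely supported map from monomials to
  coefficients, a monomial being a finitely supported map from variable indices to exponents.
  The variables \<open>T\<^sub>1, \<dots>, T\<^sub>r\<close> are indexed by \<open>0, \<dots>, r - 1\<close>.\<close>

type_synonym rat_mpoly = "(nat \<Rightarrow>\<^sub>0 nat) \<Rightarrow>\<^sub>0 rat"

definition rat_mpolys :: "nat \<Rightarrow> rat_mpoly set" where
  "rat_mpolys r = {P. \<forall>m \<in> Poly_Mapping.keys P. Poly_Mapping.keys m \<subseteq> {..<r}}"

definition eval_mpoly :: "nat \<Rightarrow> rat_mpoly \<Rightarrow> (nat \<Rightarrow> real) \<Rightarrow> real" where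
  "eval_mpoly r P t =
     (\<Sum>m \<in> Poly_Mapping.keys P.
        of_rat (Poly_Mapping.lookup P m) * (\<Prod>i<r. t i ^ Poly_Mapping.lookup m i))"

definition alg_indep_distances :: "'a topology \<Rightarrow> ('a \<Rightarrow> 'a \<Rightarrow> real) \<Rightarrow> bool" where
  "alg_indep_distances X d \<longleftrightarrow>
     (\<forall>r x y P. r > 0 \<longrightarrow>
        (\<forall>i<r. x i \<in> topspace X \<and> y i \<in> topspace X \<and> x i \<noteq> y i) \<longrightarrow>
        inj_on (\<lambda>i. {x i, y i}) {..<r} \<longrightarrow>
        P \<in> rat_mpolys r \<longrightarrow> P \<noteq> 0 \<longrightarrow>
        eval_mpoly r P (\<lambda>i. d (x i) (y i)) \<noteq> 0)"

definition AMet :: "'a topology \<Rightarrow> ('a \<Rightarrow> 'a \<Rightarrow> real) set" where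
  "AMet X = {d \<in> Met X. alg_indep_distances X d}"

end

(* A compatible metric is approximated by rounding: a locally constant map p 0 onto a
   fine net makes d (p 0 x) (p 0 y) locally constant, and rounding it up to a multiple of a power
   of 1/2 keeps it a pseudometric, now with rational values.  A small sum of pseudometrics, one
   for each of a sequence of ever finer clopen partitions, restores the topology and completeness.
   Its weights are chosen so that each distance is rational plus a Liouville-type series over an
   infinite set of indices, the sets for different pairs being almost disjoint.  Such numbers are
   algebraically independent: a polynomial relation already holds for the truncated series,
   because these are rational with small denominators, so by Rolle's theorem the partial
   derivatives vanish too, and the degree drops. *)

theory Submission
  imports Defs
begin

section \<open>Algebraic independence of lacunary series\<close>

text \<open>Distances cannot be prescribed pair by pair: to keep the topology of \<open>X\<close>,
  each level contributes a locally constant amount, so nearby pairs share their first terms.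
  Independence has to come from the tails alone, hence almost disjoint instead of disjoint index
  sets. They arise like branches of a tree: a pair owns the codes of its successive finite
  approximations, and two branches that separate share only finitely many nodes. The approximations
  are strings of bits, which is where the bound on the cardinality enters. The exponents grow like
  factorials because the degree of a relation is arbitrary: the tail must be small against every
  fixed power of the denominator of the truncation. A relation involves finitely many pairs, so the
  rational summands have a common denominator and cost only a constant factor.\<close>

definition poly_fun :: "nat \<Rightarrow> (nat \<Rightarrow> nat) set \<Rightarrow> ((nat \<Rightarrow> nat) \<Rightarrow> int) \<Rightarrow> (nat \<Rightarrow> real) \<Rightarrow> real" where
  "poly_fun r M c t = (\<Sum>m\<in>M. of_int (c m) * (\<Prod>i<r. t i ^ m i))"

text \<open>With exponents as plain functions a partial derivative is a function update. Lowering
  exponent \<open>i\<close> is injective on the monomials that contain variable \<open>i\<close>, so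
  no coefficients have to be merged.\<close>

definition pderiv_exps :: "nat \<Rightarrow> (nat \<Rightarrow> nat) set \<Rightarrow> (nat \<Rightarrow> nat) set" where
  "pderiv_exps i M = (\<lambda>m. m(i := m i - 1)) ` {m\<in>M. m i > 0}"

definition pderiv_coeff :: "nat \<Rightarrow> ((nat \<Rightarrow> nat) \<Rightarrow> int) \<Rightarrow> (nat \<Rightarrow> nat) \<Rightarrow> int" where
  "pderiv_coeff i c m = c (m(i := Suc (m i))) * int (Suc (m i))"

lemma inj_on_lower_exp: "inj_on (\<lambda>m. m(i := m i - (1::nat))) {m\<in>M. m i > 0}"
proof (rule inj_onI)
  fix m m' :: "'a \<Rightarrow> nat"
  assume a: "m \<in> {m\<in>M. m i > 0}" "m' \<in> {m\<in>M. m i > 0}" and eq: "m(i := m i - 1) = m'(i := m' i - 1)"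
  show "m = m'"
  proof
    fix k
    show "m k = m' k"
      using fun_cong[OF eq, of k] a by (cases "k = i") auto
  qed
qed

lemma poly_fun_has_derivative:
  assumes "finite M" "i < r"
  shows "((\<lambda>s. poly_fun r M c (t(i := s))) has_real_derivative
           poly_fun r (pderiv_exps i M) (pderiv_coeff i c) (t(i := s))) (at s)"
proof -
  define R where "R m = (\<Prod>k\<in>{..<r} - {i}. t k ^ m k)" for m :: "nat \<Rightarrow> nat"
  have split: "(\<Prod>k<r. (t(i := s)) k ^ m k) = s ^ m i * R m" for m s
  proof -
    have "(\<Prod>k<r. (t(i := s)) k ^ m k) = (t(i := s)) i ^ m i * (\<Prod>k\<in>{..<r} - {i}. (t(i := s)) k ^ m k)"
      using assms by (intro prod.remove) auto
    also have "(\<Prod>k\<in>{..<r} - {i}. (t(i := s)) k ^ m k) = R m"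
      unfolding R_def by (intro prod.cong) auto
    finally show ?thesis by simp
  qed
  have R_upd: "R (m(i := k)) = R m" for m k
    unfolding R_def by (intro prod.cong) auto
  have "((\<lambda>s. \<Sum>m\<in>M. of_int (c m) * (s ^ m i * R m)) has_real_derivative
          (\<Sum>m\<in>M. of_int (c m) * (real (m i) * s ^ (m i - 1) * R m))) (at s)"
    by (auto intro!: derivative_eq_intros sum.cong)
  also have "(\<Sum>m\<in>M. of_int (c m) * (real (m i) * s ^ (m i - 1) * R m)) =
      (\<Sum>m\<in>{m\<in>M. m i > 0}. of_int (c m) * (real (m i) * s ^ (m i - 1) * R m))"
    using assms by (intro sum.mono_neutral_right) auto
  also have "\<dots> = poly_fun r (pderiv_exps i M) (pderiv_coeff i c) (t(i := s))"
    unfolding poly_fun_def pderiv_exps_def split sum.reindex[OF inj_on_lower_exp]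
    by (intro sum.cong) (auto simp: R_upd pderiv_coeff_def algebra_simps simp del: of_nat_Suc)
  finally show ?thesis
    unfolding poly_fun_def split .
qed

lemma tendsto_poly_fun:
  assumes "\<And>i. i < r \<Longrightarrow> ((\<lambda>n. t n i) \<longlongrightarrow> u i) F"
  shows "((\<lambda>n. poly_fun r M c (t n)) \<longlongrightarrow> poly_fun r M c u) F"
  unfolding poly_fun_def using assms by (intro tendsto_intros) auto

text \<open>With \<open>fact n\<close> instead of \<open>fact (Suc n)\<close>, the bound \<open>liouville_term_add_le\<close> would fail at
  \<open>n = 0\<close>, because \<open>0! = 1!\<close>.\<close>

definition liouville_term :: "nat \<Rightarrow> real" where
  "liouville_term n = (1/2) ^ fact (Suc n)"

definition lacunary :: "nat set \<Rightarrow> nat \<Rightarrow> real" where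
  "lacunary S n = (if n \<in> S then liouville_term n else 0)"

section \<open>Size of the tails of Liouville-type series\<close>

lemma liouville_term_pos: "liouville_term n > 0"
  by (simp add: liouville_term_def)

lemma lacunary_nonneg: "lacunary S n \<ge> 0"
  using liouville_term_pos[of n] by (simp add: lacunary_def)

lemma liouville_term_add_le: "liouville_term (l + n) \<le> liouville_term n * (1/2) ^ l"
proof -
  have "l + fact (Suc n) \<le> fact (Suc (l + n))"
  proof (induction l)
    case (Suc l)
    have "fact (Suc (l + n)) \<ge> (1::nat)" by (rule fact_ge_1)
    moreover have "fact (Suc (Suc l + n)) =
        fact (Suc (l + n)) + Suc (l + n) * (fact (Suc (l + n)) :: nat)"
      by (subst fact_Suc) simp
    ultimately show ?case using Suc by simp
  qed auto
  then have "(1/2::real) ^ fact (Suc (l + n)) \<le> (1/2) ^ (l + fact (Suc n))"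
    by (intro power_decreasing) auto
  then show ?thesis by (simp add: liouville_term_def power_add mult.commute del: fact_Suc)
qed

lemma liouville_term_le: "liouville_term n \<le> (1/2) ^ n"
proof -
  have "liouville_term 0 \<le> 1" by (simp add: liouville_term_def)
  then have "liouville_term 0 * (1/2) ^ n \<le> 1 * (1/2) ^ n"
    by (intro mult_right_mono) auto
  moreover have "liouville_term n \<le> liouville_term 0 * (1/2) ^ n"
    using liouville_term_add_le[of n 0] by simp
  ultimately show ?thesis by linarith
qed

lemma lacunary_add_le: "lacunary S (l + n) \<le> liouville_term n * (1/2) ^ l"
  using liouville_term_add_le[of l n] liouville_term_pos[of n] by (auto simp: lacunary_def)

lemma lacunary_summable: "summable (lacunary S)"
proof (rule summable_comparison_test')
  show "summable (\<lambda>n. (1/2::real) ^ n)" by (simp add: summable_geometric)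
  show "norm (lacunary S n) \<le> (1/2) ^ n" if "n \<ge> 0" for n
    using liouville_term_le[of n] liouville_term_pos[of n] by (auto simp: lacunary_def)
qed

text \<open>The tail is dominated by a geometric series of ratio 1/2 starting at
  \<open>liouville_term n\<close>; hence the factor 2, for every \<open>S\<close> alike.\<close>

lemma lacunary_tail:
  "\<bar>suminf (lacunary S) - (\<Sum>l<n. lacunary S l)\<bar> \<le> 2 * liouville_term n"
proof -
  have s: "summable (\<lambda>l. liouville_term n * (1/2::real) ^ l)"
    by (intro summable_mult summable_geometric) auto
  have "suminf (lacunary S) - (\<Sum>l<n. lacunary S l) = suminf (\<lambda>l. lacunary S (l + n))"
    using suminf_split_initial_segment[OF lacunary_summable, of S n] by simp
  moreover have "suminf (\<lambda>l. lacunary S (l + n)) \<le> suminf (\<lambda>l. liouville_term n * (1/2) ^ l)"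
    by (intro suminf_le lacunary_add_le summable_ignore_initial_segment lacunary_summable s)
  moreover have "suminf (\<lambda>l. liouville_term n * (1/2::real) ^ l) = 2 * liouville_term n"
    by (subst suminf_mult) (auto simp: suminf_geometric summable_geometric)
  moreover have "suminf (\<lambda>l. lacunary S (l + n)) \<ge> 0"
    by (intro suminf_nonneg lacunary_nonneg summable_ignore_initial_segment lacunary_summable)
  ultimately show ?thesis by linarith
qed

text \<open>For bounded \<delta>, an error of order \<delta> survives sums and products, so
  polynomials inherit the rate without estimates of their derivatives.\<close>

definition approx_at_rate :: "(nat \<Rightarrow> real) \<Rightarrow> (nat \<Rightarrow> real) \<Rightarrow> real \<Rightarrow> bool" where
  "approx_at_rate \<delta> a l \<longleftrightarrow> (\<lambda>n. a n - l) \<in> O(\<delta>)"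

lemma approx_at_rate_const: "approx_at_rate \<delta> (\<lambda>n. l) l"
  by (simp add: approx_at_rate_def)

lemma approx_at_rate_sum:
  "(\<And>i. i \<in> I \<Longrightarrow> approx_at_rate \<delta> (a i) (l i)) \<Longrightarrow>
    approx_at_rate \<delta> (\<lambda>n. \<Sum>i\<in>I. a i n) (\<Sum>i\<in>I. l i)"
  unfolding approx_at_rate_def sum_subtractf[symmetric] by (rule big_sum_in_bigo)

lemma approx_at_rate_mult:
  assumes "\<delta> \<in> O(\<lambda>_. 1)" "approx_at_rate \<delta> a l" "approx_at_rate \<delta> b k"
  shows "approx_at_rate \<delta> (\<lambda>n. a n * b n) (l * k)"
proof -
  have a: "(\<lambda>n. a n - l) \<in> O(\<delta>)" and b: "(\<lambda>n. b n - k) \<in> O(\<delta>)"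
    using assms by (auto simp: approx_at_rate_def)
  have "(\<lambda>n. b n - k) \<in> O(\<lambda>_. 1)"
    using b assms(1) by (rule landau_o.big_trans)
  from sum_in_bigo(1)[OF this, of "\<lambda>_. k"] have "b \<in> O(\<lambda>_. 1)" by simp
  from landau_o.big.mult[OF a this] have "(\<lambda>n. (a n - l) * b n) \<in> O(\<delta>)" by simp
  moreover have "(\<lambda>n. l * (b n - k)) \<in> O(\<delta>)"
    using b by simp
  ultimately have "(\<lambda>n. (a n - l) * b n + l * (b n - k)) \<in> O(\<delta>)"
    by (rule sum_in_bigo)
  then show ?thesis by (simp add: approx_at_rate_def algebra_simps)
qed

lemma approx_at_rate_power:
  assumes "\<delta> \<in> O(\<lambda>_. 1)" "approx_at_rate \<delta> a l"
  shows "approx_at_rate \<delta> (\<lambda>n. a n ^ m) (l ^ m)"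
  by (induction m) (auto intro: approx_at_rate_const approx_at_rate_mult assms)

lemma approx_at_rate_prod:
  assumes "\<delta> \<in> O(\<lambda>_. 1)" "\<And>i. i \<in> I \<Longrightarrow> approx_at_rate \<delta> (a i) (l i)"
  shows "approx_at_rate \<delta> (\<lambda>n. \<Prod>i\<in>I. a i n) (\<Prod>i\<in>I. l i)"
  using assms(2)
  by (induction I rule: infinite_finite_induct)
     (auto intro: approx_at_rate_const approx_at_rate_mult assms(1))

lemma approx_at_rate_poly_fun:
  assumes "\<delta> \<in> O(\<lambda>_. 1)" "\<And>i. i < r \<Longrightarrow> approx_at_rate \<delta> (\<lambda>n. t n i) (u i)"
  shows "approx_at_rate \<delta> (\<lambda>n. poly_fun r M c (t n)) (poly_fun r M c u)"
  unfolding poly_fun_def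
  by (intro approx_at_rate_sum approx_at_rate_mult approx_at_rate_const approx_at_rate_prod
        approx_at_rate_power assms) auto

text \<open>A monomial uses up one factor \<open>b\<close> per variable occurrence, at most
  \<open>N\<close> in all; the factors left over are integers.\<close>

lemma poly_fun_common_denominator:
  fixes b :: real
  assumes "\<And>i. i < r \<Longrightarrow> b * t i \<in> \<int>" "b \<in> \<int>" "\<And>m. m \<in> M \<Longrightarrow> (\<Sum>i<r. m i) \<le> N"
  shows "b ^ N * poly_fun r M c t \<in> \<int>"
  unfolding poly_fun_def sum_distrib_left
proof (intro Ints_sum)
  fix m assume m: "m \<in> M"
  have "b ^ N = b ^ (N - (\<Sum>i<r. m i)) * (\<Prod>i<r. b ^ m i)"
    using assms(3)[OF m] by (simp add: power_sum[symmetric] power_add[symmetric])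
  then have "b ^ N * (of_int (c m) * (\<Prod>i<r. t i ^ m i)) =
     b ^ (N - (\<Sum>i<r. m i)) * of_int (c m) * (\<Prod>i<r. (b * t i) ^ m i)"
    by (simp add: power_mult_distrib prod.distrib)
  also have "\<dots> \<in> \<int>"
    by (intro Ints_mult Ints_prod Ints_power Ints_of_int assms(1,2)) simp
  finally show "b ^ N * (of_int (c m) * (\<Prod>i<r. t i ^ m i)) \<in> \<int>" .
qed

lemma Rats_common_denominator:
  fixes q :: "'b \<Rightarrow> real"
  assumes "finite I" "\<And>i. i \<in> I \<Longrightarrow> q i \<in> \<rat>"
  shows "\<exists>B::nat. B > 0 \<and> (\<forall>i\<in>I. real B * q i \<in> \<int>)"
  using assms
proof (induction I rule: finite_induct)
  case (insert j I)
  then obtain B where B: "B > 0" "\<forall>i\<in>I. real B * q i \<in> \<int>" by auto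
  have "q j \<in> \<rat>" using insert by auto
  then obtain a b where ab: "b > 0" "q j = of_int a / of_int b"
    by (metis Rats_cases')
  have "real (B * nat b) * q i \<in> \<int>" if "i \<in> insert j I" for i
  proof (cases "i = j")
    case True
    then show ?thesis using ab by auto
  next
    case False
    then have "real (B * nat b) * q i = real (nat b) * (real B * q i)" by simp
    also have "\<dots> \<in> \<int>" using B False that by (intro Ints_mult[of "real (nat b)"]) auto
    finally show ?thesis .
  qed
  moreover have "B * nat b > 0" using B ab by simp
  ultimately show ?case by blast
qed auto


lemma poly_fun_cong: "(\<And>i. i < r \<Longrightarrow> t i = u i) \<Longrightarrow> poly_fun r M c t = poly_fun r M c u"
  unfolding poly_fun_def by (intro sum.cong prod.cong arg_cong2[where f = "(*)"] refl) simp

lemma lacunary_partial_sum_denominator: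
  "2 ^ fact n * (\<Sum>l<n. lacunary S l) \<in> \<int>"
  unfolding sum_distrib_left
proof (intro Ints_sum)
  fix l assume "l \<in> {..<n}"
  then have "fact (Suc l) \<le> (fact n :: nat)" by (intro fact_mono) auto
  then have "(2::real) ^ fact n = 2 ^ (fact n - fact (Suc l)) * 2 ^ fact (Suc l)"
    by (simp add: power_add[symmetric] del: fact_Suc)
  then have "2 ^ fact n * liouville_term l = 2 ^ (fact n - fact (Suc l))"
    by (simp add: liouville_term_def power_one_over del: fact_Suc)
  then show "2 ^ fact n * lacunary S l \<in> \<int>"
    by (simp add: lacunary_def del: fact_Suc)
qed

text \<open>Since \<open>(n+1)! = (n+1) * n!\<close>, the exponent of the term outgrows
  \<open>N * n!\<close>. So the tail beats any fixed power of the denominator \<open>2 ^ n!\<close>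
  of the truncation.\<close>

lemma liouville_term_superpolynomial:
  "(\<lambda>n. (2 ^ fact n) ^ N * liouville_term n) \<longlonglongrightarrow> 0"
proof (rule tendsto_sandwich)
  show "\<forall>\<^sub>F n in sequentially. 0 \<le> (2 ^ fact n) ^ N * liouville_term n"
    using liouville_term_pos by (intro always_eventually allI) (simp add: less_imp_le)
  show "\<forall>\<^sub>F n in sequentially. (2 ^ fact n) ^ N * liouville_term n \<le> 2 ^ N * (1/2) ^ n"
    using eventually_ge_at_top[of N]
  proof eventually_elim
    case (elim n)
    have "n - N \<le> (n - N) * fact n" using fact_ge_1[of n, where 'a=nat] by simp
    then have "(n - N) + N * fact n \<le> (n - N) * fact n + N * fact n" by simp
    also have "\<dots> = n * fact n" using elim by (simp flip: add_mult_distrib)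
    also have "\<dots> \<le> fact (Suc n)" by simp
    finally have "n + N * fact n \<le> N + fact (Suc n)" using elim by linarith
    then have "(2::real) ^ (n + N * fact n) \<le> 2 ^ (N + fact (Suc n))"
      by (intro power_increasing) auto
    then have "(2::real) ^ (N * fact n) * (1/2) ^ fact (Suc n) \<le> 2 ^ N * (1/2) ^ n"
      by (simp add: power_add power_one_over field_simps del: fact_Suc)
    then show ?case
      by (simp add: liouville_term_def power_mult[symmetric] mult.commute del: fact_Suc)
  qed
  show "(\<lambda>n. 2 ^ N * (1 / 2) ^ n :: real) \<longlonglongrightarrow> 0"
    by (intro tendsto_mult_right_zero LIMSEQ_power_zero) auto
qed auto

text \<open>As the value at the limit is 0, the value at a truncation is of the order of the tail.
  Its multiple by \<open>(B * 2 ^ n!) ^ N\<close> is an integer, which for large \<open>n\<close> is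
  below 1 in absolute value.\<close>

lemma poly_fun_partial_sums_eventually_zero:
  fixes S :: "nat \<Rightarrow> nat set" and q :: "nat \<Rightarrow> real"
  assumes M: "finite M" and q: "\<And>j. j < r \<Longrightarrow> q j \<in> \<rat>"
    and zero: "poly_fun r M c (\<lambda>j. q j + suminf (lacunary (S j))) = 0"
  shows "\<forall>\<^sub>F n in sequentially. poly_fun r M c (\<lambda>j. q j + (\<Sum>l<n. lacunary (S j) l)) = 0"
proof -
  define T where "T n j = q j + (\<Sum>l<n. lacunary (S j) l)" for n j
  define N where "N = (\<Sum>m\<in>M. \<Sum>i<r. m i)"
  obtain B :: nat where B: "B > 0" "\<And>j. j < r \<Longrightarrow> real B * q j \<in> \<int>"
    using Rats_common_denominator[of "{..<r}" q] q by auto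
  have "liouville_term \<in> O(\<lambda>_. 1)"
  proof (rule bigoI)
    show "\<forall>\<^sub>F n in sequentially. norm (liouville_term n) \<le> 1 * norm (1::real)"
      using liouville_term_pos by (intro always_eventually allI)
        (auto simp: abs_of_pos liouville_term_def power_le_one simp del: fact_Suc)
  qed
  then have "approx_at_rate liouville_term (\<lambda>n. poly_fun r M c (T n))
      (poly_fun r M c (\<lambda>j. q j + suminf (lacunary (S j))))"
  proof (rule approx_at_rate_poly_fun)
    fix j
    have "norm (T n j - (q j + suminf (lacunary (S j)))) \<le> 2 * norm (liouville_term n)" for n
      using lacunary_tail[of "S j" n] liouville_term_pos[of n] by (simp add: T_def)
    then show "approx_at_rate liouville_term (\<lambda>n. T n j) (q j + suminf (lacunary (S j)))"
      unfolding approx_at_rate_def by (intro bigoI[of _ 2] always_eventually allI)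
  qed
  then have "(\<lambda>n. poly_fun r M c (T n)) \<in> O(liouville_term)"
    by (simp add: zero approx_at_rate_def)
  then obtain L where L: "L > 0"
    "\<forall>\<^sub>F n in sequentially. norm (poly_fun r M c (T n)) \<le> L * norm (liouville_term n)"
    by (rule landau_o.bigE)
  have "(\<lambda>n. (real B ^ N * L) * ((2 ^ fact n) ^ N * liouville_term n)) \<longlonglongrightarrow> 0"
    by (intro tendsto_mult_right_zero liouville_term_superpolynomial)
  then have "\<forall>\<^sub>F n in sequentially. (real B ^ N * L) * ((2 ^ fact n) ^ N * liouville_term n) < 1"
    by (rule order_tendstoD) simp
  with L(2) have "\<forall>\<^sub>F n in sequentially. poly_fun r M c (T n) = 0"
  proof eventually_elim
    case (elim n)
    define b where "b = real B * 2 ^ fact n"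
    have b: "b > 0" using B by (simp add: b_def)
    have "b ^ N * poly_fun r M c (T n) \<in> \<int>"
    proof (rule poly_fun_common_denominator)
      fix j assume "j < r"
      have "b * T n j = 2 ^ fact n * (real B * q j) + real B * (2 ^ fact n * (\<Sum>l<n. lacunary (S j) l))"
        by (simp add: b_def T_def algebra_simps)
      also have "\<dots> \<in> \<int>"
        by (intro Ints_add Ints_mult B(2) \<open>j < r\<close> lacunary_partial_sum_denominator) auto
      finally show "b * T n j \<in> \<int>" .
    next
      fix m assume "m \<in> M"
      then show "(\<Sum>i<r. m i) \<le> N"
        unfolding N_def using M by (intro member_le_sum) auto
    qed (simp add: b_def)
    moreover have "\<bar>b ^ N * poly_fun r M c (T n)\<bar> < 1"
    proof -
      have "\<bar>b ^ N * poly_fun r M c (T n)\<bar> = b ^ N * \<bar>poly_fun r M c (T n)\<bar>"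
        using b by (simp add: abs_mult)
      also have "\<dots> \<le> b ^ N * (L * liouville_term n)"
        using elim(1) b liouville_term_pos[of n] by (intro mult_left_mono) auto
      also have "\<dots> < 1" using elim(2) by (simp add: b_def power_mult_distrib mult_ac)
      finally show ?thesis .
    qed
    ultimately have "b ^ N * poly_fun r M c (T n) = 0"
      using Ints_nonzero_abs_less1 by blast
    then show ?case using b by simp
  qed
  then show ?thesis by (simp add: T_def[abs_def])
qed

text \<open>For large \<open>n \<in> S i\<close>, the truncations before and after \<open>n\<close> are zeros that differ in coordinate
  \<open>i\<close> only, so Rolle's theorem gives a zero of the partial derivative between them.\<close>

lemma poly_fun_pderiv_zero:
  fixes S :: "nat \<Rightarrow> nat set" and q :: "nat \<Rightarrow> real"
  assumes M: "finite M" and i: "i < r" and inf: "infinite (S i)"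
    and ad: "\<And>j. j < r \<Longrightarrow> j \<noteq> i \<Longrightarrow> finite (S i \<inter> S j)"
    and q: "\<And>j. j < r \<Longrightarrow> q j \<in> \<rat>"
    and zero: "poly_fun r M c (\<lambda>j. q j + suminf (lacunary (S j))) = 0"
  shows "poly_fun r (pderiv_exps i M) (pderiv_coeff i c) (\<lambda>j. q j + suminf (lacunary (S j))) = 0"
proof -
  let ?D = "poly_fun r (pderiv_exps i M) (pderiv_coeff i c)"
  define T where "T n j = q j + (\<Sum>l<n. lacunary (S j) l)" for n j
  have T_lim: "(\<lambda>n. T n j) \<longlonglongrightarrow> q j + suminf (lacunary (S j))" for j
    unfolding T_def by (intro tendsto_intros summable_LIMSEQ lacunary_summable)
  \<comment> \<open>From \<open>n1\<close> on, an index of \<open>S i\<close> lies in no other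
    \<open>S j\<close>.\<close>
  have "finite (\<Union>j\<in>{j. j < r \<and> j \<noteq> i}. S i \<inter> S j)"
    using ad by (intro finite_UN_I) auto
  then obtain n1 where n1: "\<forall>n\<in>(\<Union>j\<in>{j. j < r \<and> j \<noteq> i}. S i \<inter> S j). n < n1"
    using finite_nat_set_iff_bounded by auto
  obtain n2 where n2: "\<And>n. n \<ge> n2 \<Longrightarrow> poly_fun r M c (T n) = 0"
    using poly_fun_partial_sums_eventually_zero[where S = S and q = q, OF M q zero]
    unfolding T_def[abs_def] eventually_sequentially by blast
  define n0 where "n0 = max n1 n2"
  have "\<exists>s. T n i \<le> s \<and> s \<le> T (Suc n) i \<and> (n0 \<le> n \<longrightarrow> n \<in> S i \<longrightarrow> ?D ((T n)(i := s)) = 0)" for n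
  proof (cases "n0 \<le> n \<and> n \<in> S i")
    case True
    have less: "T n i < T (Suc n) i"
      using True liouville_term_pos[of n] by (simp add: T_def lacunary_def)
    have "T (Suc n) j = T n j" if "j < r" "j \<noteq> i" for j
    proof -
      have "n \<notin> S j" using n1 that True unfolding n0_def by (fastforce dest: leD)
      then show ?thesis by (simp add: T_def lacunary_def)
    qed
    then have "poly_fun r M c ((T n)(i := T (Suc n) i)) = poly_fun r M c (T (Suc n))"
      by (intro poly_fun_cong) auto
    then have "poly_fun r M c ((T n)(i := T (Suc n) i)) = 0"
      using n2[of "Suc n"] True by (simp add: n0_def)
    moreover have "poly_fun r M c ((T n)(i := T n i)) = 0"
      using n2[of n] True by (simp add: n0_def)
    moreover obtain s where "T n i < s" "s < T (Suc n) i"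
      "poly_fun r M c ((T n)(i := T (Suc n) i)) - poly_fun r M c ((T n)(i := T n i)) =
         (T (Suc n) i - T n i) * ?D ((T n)(i := s))"
      using MVT2[OF less poly_fun_has_derivative[OF M i, of c "T n"]] by blast
    ultimately show ?thesis using less by (intro exI[of _ s]) auto
  next
    case False
    then show ?thesis
      using lacunary_nonneg[of "S i" n] by (intro exI[of _ "T n i"]) (auto simp: T_def)
  qed
  then obtain \<sigma> where \<sigma>: "\<And>n. T n i \<le> \<sigma> n" "\<And>n. \<sigma> n \<le> T (Suc n) i"
    "\<And>n. n0 \<le> n \<Longrightarrow> n \<in> S i \<Longrightarrow> ?D ((T n)(i := \<sigma> n)) = 0"
    by metis
  have \<sigma>_lim: "\<sigma> \<longlonglongrightarrow> q i + suminf (lacunary (S i))"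
    by (rule tendsto_sandwich[OF _ _ T_lim[of i] LIMSEQ_Suc[OF T_lim[of i]]])
      (auto simp: \<sigma>)
  have "(\<lambda>n. ?D ((T n)(i := \<sigma> n))) \<longlonglongrightarrow> ?D (\<lambda>j. q j + suminf (lacunary (S j)))"
  proof (rule tendsto_poly_fun)
    fix j
    show "(\<lambda>n. ((T n)(i := \<sigma> n)) j) \<longlonglongrightarrow> q j + suminf (lacunary (S j))"
      using \<sigma>_lim T_lim[of j] by (cases "j = i") auto
  qed
  \<comment> \<open>The derivative is known to vanish only at indices in \<open>S i\<close>, so the
    limit is taken along that infinite set.\<close>
  from LIMSEQ_subseq_LIMSEQ[OF this strict_mono_enumerate[OF inf]]
  have lim: "(\<lambda>k. ?D ((T (enumerate (S i) k))(i := \<sigma> (enumerate (S i) k)))) \<longlonglongrightarrow>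
      ?D (\<lambda>j. q j + suminf (lacunary (S j)))"
    by (simp add: o_def)
  have "\<forall>\<^sub>F k in sequentially. ?D ((T (enumerate (S i) k))(i := \<sigma> (enumerate (S i) k))) = 0"
    using eventually_ge_at_top[of n0]
  proof eventually_elim
    case (elim k)
    have "k \<le> enumerate (S i) k" by (rule le_enumerate[OF inf])
    with elim show ?case by (intro \<sigma>(3) enumerate_in_set[OF inf]) auto
  qed
  from tendsto_cong[OF this] lim
  have "(\<lambda>k. 0) \<longlonglongrightarrow> ?D (\<lambda>j. q j + suminf (lacunary (S j)))" by simp
  then show ?thesis by (simp add: LIMSEQ_const_iff)
qed

text \<open>Induction on a degree bound. All partial derivatives vanish at the same point, so the
  induction hypothesis kills their coefficients and thereby those of all nonconstant monomials; the
  constant term is then the value of the polynomial. Exponents vanish from \<open>r\<close> on, so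
  degree 0 leaves a single monomial.\<close>

lemma poly_fun_zero_imp_coeff_zero:
  fixes S :: "nat \<Rightarrow> nat set" and q :: "nat \<Rightarrow> real"
  assumes inf: "\<And>j. j < r \<Longrightarrow> infinite (S j)"
    and ad: "\<And>i j. i < r \<Longrightarrow> j < r \<Longrightarrow> i \<noteq> j \<Longrightarrow> finite (S i \<inter> S j)"
    and q: "\<And>j. j < r \<Longrightarrow> q j \<in> \<rat>"
    and "finite M" "\<And>m. m \<in> M \<Longrightarrow> (\<Sum>i<r. m i) \<le> N" "\<And>m i. m \<in> M \<Longrightarrow> r \<le> i \<Longrightarrow> m i = 0"
    and "poly_fun r M c (\<lambda>j. q j + suminf (lacunary (S j))) = 0"
    and "m \<in> M"
  shows "c m = 0"
  using assms(4-)
proof (induction N arbitrary: M c m)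
  case 0
  then have "m' = (\<lambda>_. 0)" if "m' \<in> M" for m'
    using that by (intro ext) (metis le_zero_eq finite_lessThan lessThan_iff not_le sum_eq_0_iff)
  then have "M = {\<lambda>_. 0}" "m = (\<lambda>_. 0)" using "0.prems"(5) by blast+
  with "0.prems"(4) show ?case by (simp add: poly_fun_def)
next
  case (Suc N)
  have nonconst: "c m = 0" if m: "m \<in> M" and "m i > 0" for m i
  proof -
    have i: "i < r" using Suc.prems(3)[OF m] that(2) by (metis leI less_numeral_extra(3))
    have sum_split: "(\<Sum>k<r. m k) = m i + (\<Sum>k\<in>{..<r} - {i}. m k)" for m :: "nat \<Rightarrow> nat"
      using i by (intro sum.remove) auto
    have "pderiv_coeff i c (m(i := m i - 1)) = 0"
    proof (rule Suc.IH[where M = "pderiv_exps i M" and c = "pderiv_coeff i c"])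
      show "finite (pderiv_exps i M)"
        using Suc.prems(1) by (simp add: pderiv_exps_def)
      show "poly_fun r (pderiv_exps i M) (pderiv_coeff i c) (\<lambda>j. q j + suminf (lacunary (S j))) = 0"
        by (rule poly_fun_pderiv_zero[where S = S and q = q, OF Suc.prems(1) i inf[OF i] ad[OF i] q
              Suc.prems(4)]) auto
      show "m(i := m i - 1) \<in> pderiv_exps i M"
        using that by (auto simp: pderiv_exps_def)
    next
      fix m' assume "m' \<in> pderiv_exps i M"
      then obtain m1 where m1: "m1 \<in> M" "m1 i > 0" "m' = m1(i := m1 i - 1)"
        by (auto simp: pderiv_exps_def)
      have "(\<Sum>k\<in>{..<r} - {i}. m' k) = (\<Sum>k\<in>{..<r} - {i}. m1 k)"
        by (intro sum.cong) (auto simp: m1)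
      then have "Suc (\<Sum>k<r. m' k) = (\<Sum>k<r. m1 k)"
        using m1 unfolding sum_split by auto
      then show "(\<Sum>k<r. m' k) \<le> N" using Suc.prems(2)[OF m1(1)] by simp
    next
      fix m' j assume "m' \<in> pderiv_exps i M" "r \<le> j"
      then show "m' j = 0" using Suc.prems(3) i by (auto simp: pderiv_exps_def)
    qed
    then show ?thesis using that by (simp add: pderiv_coeff_def)
  qed
  show ?case
  proof (cases "m = (\<lambda>_. 0)")
    case True
    have "poly_fun r M c (\<lambda>j. q j + suminf (lacunary (S j))) =
        of_int (c m) + (\<Sum>m'\<in>M - {m}. of_int (c m') * (\<Prod>i<r. (q i + suminf (lacunary (S i))) ^ m' i))"
      unfolding poly_fun_def using Suc.prems True by (subst sum.remove[of M m]) auto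
    also have "(\<Sum>m'\<in>M - {m}. of_int (c m') * (\<Prod>i<r. (q i + suminf (lacunary (S i))) ^ m' i)) = 0"
    proof (intro sum.neutral ballI)
      fix m' assume m': "m' \<in> M - {m}"
      then obtain k where "m' k \<noteq> 0" using True by (auto simp: fun_eq_iff)
      then have "c m' = 0" using nonconst[of m' k] m' by simp
      then show "of_int (c m') * (\<Prod>i<r. (q i + suminf (lacunary (S i))) ^ m' i) = 0" by simp
    qed
    finally show ?thesis using Suc.prems(4) by simp
  next
    case False
    then obtain k where "m k \<noteq> 0" by (auto simp: fun_eq_iff)
    then show ?thesis using nonconst Suc.prems(5) by blast
  qed
qed

lemma lacunary_algebraically_independent:
  fixes S :: "nat \<Rightarrow> nat set" and q :: "nat \<Rightarrow> real"
  assumes inf: "\<And>j. j < r \<Longrightarrow> infinite (S j)"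
    and ad: "\<And>i j. i < r \<Longrightarrow> j < r \<Longrightarrow> i \<noteq> j \<Longrightarrow> finite (S i \<inter> S j)"
    and q: "\<And>j. j < r \<Longrightarrow> q j \<in> \<rat>"
    and P: "P \<in> rat_mpolys r" "P \<noteq> 0"
  shows "eval_mpoly r P (\<lambda>j. q j + suminf (lacunary (S j))) \<noteq> 0"
proof
  let ?K = "Poly_Mapping.keys P" and ?\<xi> = "\<lambda>j. q j + suminf (lacunary (S j))"
  assume zero: "eval_mpoly r P ?\<xi> = 0"
  obtain B :: nat where B: "B > 0"
    "\<And>m. m \<in> ?K \<Longrightarrow> real B * of_rat (Poly_Mapping.lookup P m) \<in> \<int>"
    using Rats_common_denominator[of ?K "\<lambda>m. of_rat (Poly_Mapping.lookup P m)"] by auto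
  \<comment> \<open>The floor is exact on \<open>M\<close>, because \<open>B\<close> clears the
    denominators of all coefficients.\<close>
  define c where "c f = \<lfloor>real B * of_rat (Poly_Mapping.lookup P (Poly_Mapping.Abs_poly_mapping f))\<rfloor>" for f
  define M where "M = Poly_Mapping.lookup ` ?K"
  have c: "of_int (c (Poly_Mapping.lookup m)) = real B * of_rat (Poly_Mapping.lookup P m)"
    if "m \<in> ?K" for m
    using B(2)[OF that] by (simp add: c_def Poly_Mapping.lookup_inverse)
  have M: "finite M" by (simp add: M_def)
  have "poly_fun r M c ?\<xi> = real B * eval_mpoly r P ?\<xi>"
    unfolding poly_fun_def M_def eval_mpoly_def sum_distrib_left
    by (subst sum.reindex) (auto simp: inj_on_def c mult.assoc intro!: sum.cong poly_mapping_eqI)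
  then have "poly_fun r M c ?\<xi> = 0" using zero by simp
  obtain m where m: "m \<in> ?K" using P(2) by (metis keys_eq_empty ex_in_conv)
  have "c (Poly_Mapping.lookup m) = 0"
  proof (rule poly_fun_zero_imp_coeff_zero[OF inf ad q M _ _ \<open>poly_fun r M c ?\<xi> = 0\<close>])
    fix m assume "m \<in> M"
    then show "(\<Sum>i<r. m i) \<le> (\<Sum>m\<in>M. \<Sum>i<r. m i)"
      using M by (intro member_le_sum) auto
  next
    fix m i assume "m \<in> M" "r \<le> i"
    then obtain m' where "m' \<in> ?K" "m = Poly_Mapping.lookup m'" by (auto simp: M_def)
    moreover from this have "Poly_Mapping.keys m' \<subseteq> {..<r}"
      using P(1) by (simp add: rat_mpolys_def)
    ultimately show "m i = 0"
      using \<open>r \<le> i\<close> by (metis in_keys_iff lessThan_iff not_le subsetD)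
  qed (use m in \<open>auto simp: M_def\<close>)
  with c[OF m] B(1) m show False by (simp add: in_keys_iff)
qed

section \<open>Clopen partitions of small mesh\<close>

text \<open>A refinement of order 1 of the cover by the two complements is a disjoint family of open
  sets. A member that meets \<open>A\<close> must lie in the complement of \<open>B\<close>; the
  union of these members is clopen.\<close>

lemma strongly_zero_dimensional_clopen_separation:
  assumes X: "strongly_zero_dimensional X"
    and AB: "closedin X A" "closedin X B" "A \<inter> B = {}"
  obtains C where "openin X C" "closedin X C" "A \<subseteq> C" "C \<inter> B = {}"
proof (cases "topspace X = {}")
  case True
  then have "A = {}" using AB(1) closedin_subset by blast
  then show ?thesis using that[of "{}"] by auto
next
  case False
  then have dim: "covering_dim_le X 0"
    using X by (auto simp: strongly_zero_dimensional_def has_covering_dim_def)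
  let ?\<U> = "{topspace X - A, topspace X - B}"
  have "finite ?\<U>" "\<forall>U\<in>?\<U>. openin X U" "\<Union>?\<U> = topspace X"
    using AB closedin_subset by auto
  then have "\<exists>\<V>. finite \<V> \<and> (\<forall>V\<in>\<V>. openin X V) \<and> \<Union>\<V> = topspace X \<and>
      (\<forall>V\<in>\<V>. \<exists>U\<in>?\<U>. V \<subseteq> U) \<and>
      (\<forall>x\<in>topspace X. int (card {V\<in>\<V>. x \<in> V}) \<le> 0 + 1)"
    by (intro dim[unfolded covering_dim_le_def, THEN spec, THEN mp] conjI)
  then obtain \<V> where V: "finite \<V>" "\<forall>V\<in>\<V>. openin X V" "\<Union>\<V> = topspace X"
    "\<forall>V\<in>\<V>. \<exists>U\<in>?\<U>. V \<subseteq> U" "\<forall>x\<in>topspace X. int (card {V\<in>\<V>. x \<in> V}) \<le> 0 + 1"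
    by (elim exE conjE) (rule that)
  have disj: "V = W" if "V \<in> \<V>" "W \<in> \<V>" "x \<in> V" "x \<in> W" for V W x
  proof -
    have "x \<in> topspace X" using V(3) that by blast
    then have "card {V\<in>\<V>. x \<in> V} \<le> 1" using V(5) by fastforce
    then show ?thesis
      using V(1) that card_le_Suc0_iff_eq[of "{V\<in>\<V>. x \<in> V}"] by auto
  qed
  define C where "C = \<Union>{V\<in>\<V>. V \<inter> A \<noteq> {}}"
  have "topspace X - C = \<Union>{V\<in>\<V>. V \<inter> A = {}}"
  proof
    show "topspace X - C \<subseteq> \<Union>{V\<in>\<V>. V \<inter> A = {}}"
      unfolding C_def V(3)[symmetric] by blast
    show "\<Union>{V\<in>\<V>. V \<inter> A = {}} \<subseteq> topspace X - C"
    proof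
      fix x assume "x \<in> \<Union>{V\<in>\<V>. V \<inter> A = {}}"
      then obtain V where V': "V \<in> \<V>" "V \<inter> A = {}" "x \<in> V" by blast
      then have "x \<notin> C" unfolding C_def using disj[OF V'(1) _ V'(3)] by blast
      then show "x \<in> topspace X - C" using V' V(3) by blast
    qed
  qed
  moreover have "openin X (\<Union>{V\<in>\<V>. V \<inter> A = {}})" using V(2) by blast
  moreover have "C \<subseteq> topspace X" using V(3) by (auto simp: C_def)
  ultimately have "closedin X C" by (simp add: closedin_def)
  moreover have "openin X C" unfolding C_def using V(2) by blast
  moreover have "A \<subseteq> C" using V(3) closedin_subset[OF AB(1)] unfolding C_def by blast
  moreover have "C \<inter> B = {}" using V(4) unfolding C_def by auto
  ultimately show ?thesis by (intro that)
qed

text \<open>For a well-ordering of the centres, the sets \<open>A n a\<close> below cover the space, and for fixed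
  \<open>n\<close> they are uniformly separated from each other; this avoids paracompactness.\<close>

lemma (in Metric_space) clopen_partition:
  assumes X: "strongly_zero_dimensional mtopology" and \<eta>: "\<eta> > 0"
  obtains p where "\<And>x. x \<in> M \<Longrightarrow> p x \<in> M" "\<And>x. x \<in> M \<Longrightarrow> d x (p x) < \<eta>"
    "\<And>x. x \<in> M \<Longrightarrow> openin mtopology {y\<in>M. p y = p x}"
proof -
  obtain r :: "'a rel" where r: "Well_order r" "Field r = UNIV"
    using well_ordering by (elim exE conjE)
  define R where "R = r - Id"
  have "wf R" using r(1) unfolding R_def well_order_on_def by (rule conjunct2)
  have "total_on UNIV r"
    using r unfolding well_order_on_def linear_order_on_def by simp
  then have tot: "(a, b) \<in> R \<or> (b, a) \<in> R" if "a \<noteq> b" for a b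
    using that unfolding R_def total_on_def by blast
  \<comment> \<open>\<open>a\<close> is the first centre within \<eta> of each point of
    \<open>A n a\<close>; the margin \<open>1 / (n+1)\<close> yields the separation.\<close>
  define A where "A n a = {x\<in>M. d a x \<le> \<eta> - 1 / real (Suc n) \<and> (\<forall>b\<in>M. (b, a) \<in> R \<longrightarrow> \<eta> \<le> d b x)}"
    \<comment> \<open>The number below is a third of the margin, so that neighbourhoods of radius
      \<open>\<delta> n\<close> of different sets stay disjoint.\<close>
    for n a
  define \<delta> where "\<delta> n = 1 / (3 * real (Suc n))" for n
  have \<delta>: "\<delta> n > 0" "1 / real (Suc n) = 3 * \<delta> n" for n
    by (simp_all add: \<delta>_def del: of_nat_Suc)
  have A_sub: "A n a \<subseteq> M" for n a by (auto simp: A_def)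
  have A_cover: "\<exists>n. \<exists>a\<in>M. x \<in> A n a" if x: "x \<in> M" for x
  proof -
    have "x \<in> {a\<in>M. d a x < \<eta>}" using x \<eta> by simp
    then obtain a where a: "a \<in> {a\<in>M. d a x < \<eta>}" "\<And>b. (b, a) \<in> R \<Longrightarrow> b \<notin> {a\<in>M. d a x < \<eta>}"
      by (rule wfE_min[OF \<open>wf R\<close>]) (rule that)
    then obtain n where "inverse (real (Suc n)) < \<eta> - d a x"
      using reals_Archimedean[of "\<eta> - d a x"] by auto
    then have "x \<in> A n a" using a x by (auto simp: A_def inverse_eq_divide not_less)
    then show ?thesis using a by blast
  qed
  \<comment> \<open>\<open>y\<close> avoids the \<eta>-ball of the earlier centre \<open>a\<close>,
    whereas \<open>x\<close> lies in it with a margin.\<close>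
  have sep': "3 * \<delta> n \<le> d x y" if "(a, b) \<in> R" "a \<in> M" "b \<in> M" "x \<in> A n a" "y \<in> A n b" for n a b x y
  proof -
    have "d a y \<le> d a x + d x y" using that A_sub by (intro triangle) auto
    then show ?thesis using that \<delta>(2)[of n] by (auto simp: A_def)
  qed
  have sep: "3 * \<delta> n \<le> d x y" if "a \<noteq> b" "a \<in> M" "b \<in> M" "x \<in> A n a" "y \<in> A n b" for n a b x y
    using sep' that tot commute by metis
  define O1 where "O1 n a = {x\<in>M. \<exists>y\<in>A n a. d y x < \<delta> n}" for n a
  have O1_open: "openin mtopology (O1 n a)" for n a
  proof -
    have "O1 n a = (\<Union>y\<in>A n a. mball y (\<delta> n))"
      using A_sub unfolding O1_def by fastforce
    then show ?thesis by auto
  qed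
  \<comment> \<open>A clopen set squeezed in at each level can later be removed from the following
    levels without losing openness.\<close>
  have "\<exists>C. openin mtopology C \<and> closedin mtopology C \<and> (\<Union>a\<in>M. A n a) \<subseteq> C \<and> C \<subseteq> (\<Union>a\<in>M. O1 n a)" for n
  proof -
    let ?F = "mtopology closure_of (\<Union>a\<in>M. A n a)"
    have "?F \<subseteq> (\<Union>a\<in>M. O1 n a)"
    proof
      fix x assume "x \<in> ?F"
      then have x: "x \<in> M" "\<forall>r>0. \<exists>y\<in>(\<Union>a\<in>M. A n a). y \<in> mball x r"
        by (auto simp: metric_closure_of)
      then obtain y a where "a \<in> M" "y \<in> A n a" "y \<in> mball x (\<delta> n)" using \<delta> by blast
      moreover from this have "d y x < \<delta> n" by (simp add: commute[of y x])
      ultimately show "x \<in> (\<Union>a\<in>M. O1 n a)" using x(1) unfolding O1_def by blast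
    qed
    then have disj: "?F \<inter> (topspace mtopology - (\<Union>a\<in>M. O1 n a)) = {}" by blast
    have "closedin mtopology (topspace mtopology - (\<Union>a\<in>M. O1 n a))"
      using O1_open by (intro closedin_diff closedin_topspace openin_Union) auto
    from this disj obtain C where C: "openin mtopology C" "closedin mtopology C" "?F \<subseteq> C"
      "C \<inter> (topspace mtopology - (\<Union>a\<in>M. O1 n a)) = {}"
      by (rule strongly_zero_dimensional_clopen_separation[OF X closedin_closure_of]) (rule that)
    moreover have "(\<Union>a\<in>M. A n a) \<subseteq> ?F"
      using A_sub by (intro closure_of_subset) auto
    moreover have "C \<subseteq> topspace mtopology" using C(1) by (rule openin_subset)
    ultimately show ?thesis by blast
  qed
  then obtain C where C: "\<And>n. openin mtopology (C n)" "\<And>n. closedin mtopology (C n)"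
    "\<And>n. (\<Union>a\<in>M. A n a) \<subseteq> C n" "\<And>n. C n \<subseteq> (\<Union>a\<in>M. O1 n a)" by metis
  \<comment> \<open>Each point goes to the first level whose clopen set contains it; there its
    centre is unique.\<close>
  define N where "N x = (LEAST n. x \<in> C n)" for x
  define p where "p x = (THE a. a \<in> M \<and> x \<in> O1 (N x) a)" for x
  have N: "x \<in> C (N x)" if "x \<in> M" for x
    unfolding N_def using A_cover[OF that] C(3) by (metis LeastI UN_I subsetD)
  have O1_unique: "a = b" if ab: "a \<in> M" "b \<in> M" "x \<in> O1 n a" "x \<in> O1 n b" for a b x n
  proof (rule ccontr)
    assume "a \<noteq> b"
    obtain y z where yz: "y \<in> A n a" "z \<in> A n b" "d y x < \<delta> n" "d z x < \<delta> n" "x \<in> M"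
      using ab by (auto simp: O1_def)
    have "3 * \<delta> n \<le> d y z" using sep[OF \<open>a \<noteq> b\<close>] ab yz by blast
    moreover have "d y z \<le> d y x + d x z" using yz A_sub by (intro triangle) auto
    ultimately show False using yz \<delta>(1)[of n] commute[of x z] by linarith
  qed
  have p_eqI: "p x = a" if "a \<in> M" "x \<in> O1 (N x) a" for x a
    unfolding p_def using that O1_unique by (intro the_equality) blast+
  have p: "p x \<in> M \<and> x \<in> O1 (N x) (p x)" if x: "x \<in> M" for x
  proof -
    obtain a where "a \<in> M" "x \<in> O1 (N x) a" using N[OF x] C(4) by blast
    then show ?thesis using p_eqI by metis
  qed
  show ?thesis
  proof
    fix x assume x: "x \<in> M"
    show "p x \<in> M" using p[OF x] by simp
    obtain y where y: "y \<in> A (N x) (p x)" "d y x < \<delta> (N x)" using p[OF x] by (auto simp: O1_def)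
    have "d (p x) x \<le> d (p x) y + d y x" using p[OF x] x y A_sub by (intro triangle) auto
    then show "d x (p x) < \<eta>"
      using y \<delta>(2)[of "N x"] \<delta>(1)[of "N x"] commute[of x "p x"] by (auto simp: A_def)
    have nbhd: "\<exists>V. openin mtopology V \<and> z \<in> V \<and> V \<subseteq> {y\<in>M. p y = p z}" if z: "z \<in> M" for z
    proof (intro exI conjI)
      \<comment> \<open>On this open set both the level and the centre are those of
        \<open>z\<close>.\<close>
      let ?V = "(C (N z) \<inter> O1 (N z) (p z)) - (\<Union>m<N z. C m)"
      show "openin mtopology ?V"
        using C O1_open by (intro openin_diff openin_Int closedin_Union) auto
      show "z \<in> ?V" using N[OF z] p[OF z] by (auto simp: N_def dest: not_less_Least)
      show "?V \<subseteq> {y\<in>M. p y = p z}"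
      proof
        fix y assume y: "y \<in> ?V"
        have "N y = N z"
          unfolding N_def[of y] using y by (intro Least_equality) (auto simp: not_less[symmetric])
        then show "y \<in> {y\<in>M. p y = p z}"
          using y p[OF z] p_eqI[of "p z" y] by (auto simp: O1_def)
      qed
    qed
    show "openin mtopology {y\<in>M. p y = p x}"
    proof (subst openin_subopen, intro ballI)
      fix z assume "z \<in> {y\<in>M. p y = p x}"
      then show "\<exists>T. openin mtopology T \<and> z \<in> T \<and> T \<subseteq> {y \<in> M. p y = p x}"
        using nbhd[of z] by auto
    qed
  qed
qed

section \<open>The perturbed metric\<close>

lemma exists_small_power:
  assumes "r > 0"
  obtains m :: nat where "m > 0" "2 * (1/2::real) ^ m < r"
proof -
  obtain n where "(1/2::real) ^ n < r / 2"
    using real_arch_pow_inv[of "r / 2" "1/2"] assms by auto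
  moreover have "(1/2::real) ^ Suc n \<le> (1/2) ^ n" by simp
  ultimately have "2 * (1/2) ^ Suc n < r" by linarith
  then show ?thesis using that[of "Suc n"] by simp
qed

lemma summable_geometric_bound: "summable (\<lambda>m. 2 * (1/2::real) ^ (m + k))"
  by (intro summable_mult summable_ignore_initial_segment summable_geometric) auto

lemma suminf_geometric_bound: "suminf (\<lambda>m. 2 * (1/2::real) ^ (m + k)) = 4 * (1/2) ^ k"
proof -
  have "suminf (\<lambda>m. 2 * (1/2::real) ^ (m + k)) = suminf (\<lambda>m. (2 * (1/2) ^ k) * (1/2) ^ m)"
    by (simp add: power_add mult_ac)
  also have "\<dots> = 4 * (1/2) ^ k"
    by (subst suminf_mult) (auto simp: suminf_geometric summable_geometric)
  finally show ?thesis .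
qed

text \<open>\<open>d\<close> is the metric to approximate, so \<open>p 0\<close> is measured by it.
  \<open>d'\<close> supplies the topology and, when wanted, completeness, which \<open>d\<close> may
  lack; it controls the other partitions. The injection \<open>f\<close> supplies the bits that are
  coded.\<close>

locale near_metric_data =
  fixes X :: "'a topology" and d d' :: "'a \<Rightarrow> 'a \<Rightarrow> real"
    and p :: "nat \<Rightarrow> 'a \<Rightarrow> 'a" and j :: nat and f :: "'a \<Rightarrow> nat set"
  assumes d_Met: "d \<in> Met X" and d'_Met: "d' \<in> Met X"
    and p_in: "x \<in> topspace X \<Longrightarrow> p n x \<in> topspace X"
    and p_open: "x \<in> topspace X \<Longrightarrow> openin X {y\<in>topspace X. p n y = p n x}"
    and p_0: "x \<in> topspace X \<Longrightarrow> d x (p 0 x) < (1/2) ^ j"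
    and p_pos: "x \<in> topspace X \<Longrightarrow> n > 0 \<Longrightarrow> d' x (p n x) < (1/2) ^ n"
    and inj_f: "inj_on f (topspace X)"
begin

sublocale d: Metric_space "topspace X" d
  using d_Met by (simp add: Met_def)

sublocale d': Metric_space "topspace X" d'
  using d'_Met by (simp add: Met_def)

lemma d'_mtopology: "d'.mtopology = X"
  using d'_Met by (simp add: Met_def)

text \<open>The distances have the form \<open>q + suminf (lacunary S)\<close> with rational \<open>q\<close>, where \<open>S\<close> is infinite
  and the sets belonging to different pairs are almost disjoint: \<open>pair_code x y m\<close> is built from the
  first \<open>m\<close> bits of finitely many points, so it is locally constant in \<open>x\<close> and \<open>y\<close>, yet tells any
  two pairs apart from some \<open>m\<close> on.  All nonzero values of \<open>level_dist\<close> at level \<open>m\<close> lie between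
  \<open>s\<close> and \<open>2 * s\<close> for \<open>s = (1/2) ^ (m + j)\<close>, hence the triangle inequality.\<close>

definition same_class :: "nat \<Rightarrow> 'a \<Rightarrow> 'a \<Rightarrow> bool" where
  "same_class m x y \<longleftrightarrow> (\<forall>n\<le>m. p n x = p n y)"

definition class_code :: "nat \<Rightarrow> 'a \<Rightarrow> nat" where
  "class_code m x = list_encode (map (\<lambda>n. set_encode (f (p n x) \<inter> {..<m})) [0..<Suc m])"

definition pair_code :: "'a \<Rightarrow> 'a \<Rightarrow> nat \<Rightarrow> nat" where
  "pair_code x y m = prod_encode (m + j, set_encode {class_code m x, class_code m y})"

definition level_dist :: "'a \<Rightarrow> 'a \<Rightarrow> nat \<Rightarrow> real" where
  "level_dist x y m =
     (if same_class m x y then 0 else (1/2) ^ (m + j) + liouville_term (pair_code x y m))"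

definition grid_dist :: "'a \<Rightarrow> 'a \<Rightarrow> real" where
  "grid_dist x y = (1/2) ^ j * of_int \<lceil>2 ^ j * d (p 0 x) (p 0 y)\<rceil>"

definition near_dist :: "'a \<Rightarrow> 'a \<Rightarrow> real" where
  "near_dist x y = grid_dist x y + suminf (level_dist x y)"

section \<open>Classes, level pseudometrics and the rounded metric\<close>

lemma same_class_refl: "same_class m x x"
  and same_class_sym: "same_class m x y \<Longrightarrow> same_class m y x"
  and same_class_trans: "same_class m x y \<Longrightarrow> same_class m y z \<Longrightarrow> same_class m x z"
  and same_class_mono: "same_class n x y \<Longrightarrow> m \<le> n \<Longrightarrow> same_class m x y"
  by (auto simp: same_class_def)

lemma class_code_cong: "same_class m x y \<Longrightarrow> class_code m x = class_code m y"
  by (auto simp: class_code_def same_class_def simp del: upt_Suc intro!: arg_cong[of _ _ list_encode])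

lemma pair_code_commute: "pair_code x y = pair_code y x"
  by (auto simp: pair_code_def insert_commute)

lemma openin_same_class:
  assumes "x \<in> topspace X"
  shows "openin X {y\<in>topspace X. same_class m x y}"
proof -
  have "{y\<in>topspace X. same_class m x y} = (\<Inter>n\<in>{..m}. {y\<in>topspace X. p n y = p n x})"
    by (auto simp: same_class_def)
  then show ?thesis using p_open[OF assms] by (auto intro!: openin_Inter)
qed

lemma d'_less_if_p_eq:
  assumes "x \<in> topspace X" "y \<in> topspace X" "n > 0" "p n x = p n y"
  shows "d' x y < 2 * (1/2) ^ n"
proof -
  have "d' x y \<le> d' x (p n x) + d' (p n x) y"
    using assms p_in by (intro d'.triangle) auto
  moreover have "d' (p n x) y < (1/2) ^ n"
    using p_pos[of y n] assms d'.commute by simp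
  ultimately show ?thesis using p_pos[of x n] assms by linarith
qed

lemma exists_p_neq:
  assumes "x \<in> topspace X" "y \<in> topspace X" "x \<noteq> y"
  obtains n where "n > 0" "p n x \<noteq> p n y"
proof -
  have "d' x y > 0" using assms d'.mdist_pos_less by simp
  then obtain n where "(1/2::real) ^ n < d' x y / 2"
    using real_arch_pow_inv[of "d' x y / 2" "1/2"] by auto
  moreover have "(1/2::real) ^ Suc n \<le> (1/2) ^ n" by simp
  ultimately have "2 * (1/2) ^ Suc n \<le> d' x y" by linarith
  then have "p (Suc n) x \<noteq> p (Suc n) y" using d'_less_if_p_eq[of x y "Suc n"] assms by auto
  then show ?thesis using that[of "Suc n"] by simp
qed

lemma level_dist_nonneg: "level_dist x y m \<ge> 0"
  using liouville_term_pos[of "pair_code x y m"] by (simp add: level_dist_def)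

lemma level_dist_ge: "\<not> same_class m x y \<Longrightarrow> (1/2) ^ (m + j) \<le> level_dist x y m"
  using liouville_term_pos[of "pair_code x y m"] by (simp add: level_dist_def)

text \<open>\<open>prod_encode\<close> dominates its first component, here \<open>m + j\<close>. So
  the perturbation at most doubles the main weight.\<close>

lemma liouville_term_pair_code_le: "liouville_term (pair_code x y m) \<le> (1/2) ^ (m + j)"
proof -
  have "m + j \<le> pair_code x y m" unfolding pair_code_def by (rule le_prod_encode_1)
  then have "(1/2::real) ^ pair_code x y m \<le> (1/2) ^ (m + j)" by (intro power_decreasing) auto
  with liouville_term_le[of "pair_code x y m"] show ?thesis by linarith
qed

lemma level_dist_le: "level_dist x y m \<le> 2 * (1/2) ^ (m + j)"
  using liouville_term_pair_code_le[of x y m] by (simp add: level_dist_def)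

lemma level_dist_commute: "level_dist x y = level_dist y x"
  using same_class_sym pair_code_commute[of x y] by (fastforce simp: level_dist_def)

lemma level_dist_triangle: "level_dist x z m \<le> level_dist x y m + level_dist y z m"
proof -
  \<comment> \<open>\<open>level_dist\<close> sees a point only through its class of level
    \<open>m\<close>.\<close>
  have cong: "level_dist x z m = level_dist y z m" if "same_class m x y" for x y z
    using class_code_cong[OF that] that same_class_trans same_class_sym
    unfolding level_dist_def pair_code_def by metis
  consider "same_class m x y" | "same_class m y z" | "\<not> same_class m x y" "\<not> same_class m y z" by blast
  then show ?thesis
  proof cases
    case 1
    then show ?thesis using cong[of x y z] level_dist_nonneg[of x y m] by simp
  next
    case 2
    then show ?thesis
      using cong[of y z x] level_dist_nonneg[of y z m] level_dist_commute by simp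
  next
    case 3
    then show ?thesis 
      using level_dist_le[of x z m] level_dist_ge[of m x y] level_dist_ge[of m y z] by linarith
  qed
qed

lemma level_dist_summable: "summable (level_dist x y)"
  by (rule summable_comparison_test'[OF summable_geometric_bound[of j]])
    (use level_dist_le level_dist_nonneg in auto)

lemma suminf_level_dist_tail_le: "suminf (\<lambda>l. level_dist x y (l + n)) \<le> 4 * (1/2) ^ (n + j)"
  unfolding suminf_geometric_bound[symmetric]
  by (intro suminf_le summable_ignore_initial_segment level_dist_summable summable_geometric_bound)
    (use level_dist_le[of x y "_ + n"] in \<open>simp add: add.assoc\<close>)

lemma suminf_level_dist_nonneg: "suminf (level_dist x y) \<ge> 0"
  by (intro suminf_nonneg level_dist_summable level_dist_nonneg)

lemma grid_dist_nonneg: "grid_dist x y \<ge> 0"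
proof -
  have "(0::real) \<le> 2 ^ j * d (p 0 x) (p 0 y)" by simp
  then have "0 \<le> \<lceil>2 ^ j * d (p 0 x) (p 0 y)\<rceil>" by linarith
  then show ?thesis by (simp add: grid_dist_def)
qed

text \<open>The ceiling is monotone and subadditive; the floor is not subadditive, which is why
  values are rounded up.\<close>

lemma grid_dist_triangle:
  assumes "x \<in> topspace X" "y \<in> topspace X" "z \<in> topspace X"
  shows "grid_dist x z \<le> grid_dist x y + grid_dist y z"
proof -
  have "d (p 0 x) (p 0 z) \<le> d (p 0 x) (p 0 y) + d (p 0 y) (p 0 z)"
    using assms p_in by (intro d.triangle) auto
  then have "(2::real) ^ j * d (p 0 x) (p 0 z) \<le> 2 ^ j * (d (p 0 x) (p 0 y) + d (p 0 y) (p 0 z))"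
    by (intro mult_left_mono) auto
  then have "2 ^ j * d (p 0 x) (p 0 z) \<le> 2 ^ j * d (p 0 x) (p 0 y) + 2 ^ j * d (p 0 y) (p 0 z)"
    by (simp add: distrib_left)
  then have "\<lceil>2 ^ j * d (p 0 x) (p 0 z)\<rceil> \<le> \<lceil>2 ^ j * d (p 0 x) (p 0 y)\<rceil> + \<lceil>2 ^ j * d (p 0 y) (p 0 z)\<rceil>"
    by linarith
  then have "real_of_int \<lceil>2 ^ j * d (p 0 x) (p 0 z)\<rceil> \<le>
      real_of_int \<lceil>2 ^ j * d (p 0 x) (p 0 y)\<rceil> + real_of_int \<lceil>2 ^ j * d (p 0 y) (p 0 z)\<rceil>"
    by linarith
  then show ?thesis
    unfolding grid_dist_def distrib_left[symmetric] by (intro mult_left_mono) auto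
qed

lemma grid_dist_bounds:
  "d (p 0 x) (p 0 y) \<le> grid_dist x y" "grid_dist x y \<le> d (p 0 x) (p 0 y) + (1/2) ^ j"
proof -
  define D where "D = d (p 0 x) (p 0 y)"
  have one: "(1/2::real) ^ j * 2 ^ j = 1" by (simp add: power_mult_distrib[symmetric])
  have "2 ^ j * D \<le> of_int \<lceil>2 ^ j * D\<rceil>" "of_int \<lceil>2 ^ j * D\<rceil> \<le> 2 ^ j * D + 1" by linarith+
  then have "(1/2) ^ j * (2 ^ j * D) \<le> (1/2) ^ j * of_int \<lceil>2 ^ j * D\<rceil>"
    "(1/2) ^ j * of_int \<lceil>2 ^ j * D\<rceil> \<le> (1/2) ^ j * (2 ^ j * D + 1)"
    by (intro mult_left_mono; simp)+
  then show "d (p 0 x) (p 0 y) \<le> grid_dist x y" "grid_dist x y \<le> d (p 0 x) (p 0 y) + (1/2) ^ j"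
    unfolding grid_dist_def D_def[symmetric] distrib_left mult.assoc[symmetric] one by simp_all
qed

section \<open>Approximation, topology and completeness\<close>

lemma near_dist_approx:
  assumes "x \<in> topspace X" "y \<in> topspace X"
  shows "\<bar>d x y - near_dist x y\<bar> \<le> 7 * (1/2) ^ j"
proof -
  have in_X: "p 0 x \<in> topspace X" "p 0 y \<in> topspace X" using assms p_in by auto
  have "d x y \<le> d x (p 0 x) + d (p 0 x) (p 0 y) + d (p 0 y) y"
    using d.triangle[of x "p 0 x" y] d.triangle[of "p 0 x" "p 0 y" y] in_X assms by linarith
  moreover have "d (p 0 x) (p 0 y) \<le> d (p 0 x) x + d x y + d y (p 0 y)"
    using d.triangle[of "p 0 x" x "p 0 y"] d.triangle[of x y "p 0 y"] in_X assms by linarith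
  moreover have "d x (p 0 x) < (1/2) ^ j" "d (p 0 x) x < (1/2) ^ j"
    "d y (p 0 y) < (1/2) ^ j" "d (p 0 y) y < (1/2) ^ j"
    using p_0[OF assms(1)] p_0[OF assms(2)] d.commute by auto
  \<comment> \<open>7 = 2 + 1 + 4: moving both endpoints, rounding up, and the series over all
    levels.\<close>
  ultimately show ?thesis
    using grid_dist_bounds[of x y] suminf_level_dist_nonneg[of x y] suminf_level_dist_tail_le[of x y 0]
    unfolding near_dist_def by simp
qed

text \<open>Levels up to \<open>m\<close> contribute nothing and the later ones at most
  \<open>4 * (1/2) ^ (m + 1 + j)\<close>. Classes take \<open>p 0\<close> into account, so the grid
  part vanishes as well.\<close>

lemma near_dist_le_if_same_class:
  assumes "x \<in> topspace X" "same_class m x y"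
  shows "near_dist x y \<le> 2 * (1/2) ^ (m + j)"
proof -
  have "p 0 x = p 0 y" using assms by (simp add: same_class_def)
  then have "grid_dist x y = 0" using p_in[OF assms(1), of 0] by (simp add: grid_dist_def)
  moreover have "(\<Sum>l<Suc m. level_dist x y l) = 0"
    using assms(2) same_class_mono[of m x y] by (intro sum.neutral) (auto simp: level_dist_def)
  moreover have "suminf (level_dist x y) =
      suminf (\<lambda>l. level_dist x y (l + Suc m)) + (\<Sum>l<Suc m. level_dist x y l)"
    by (rule suminf_split_initial_segment[OF level_dist_summable])
  ultimately show ?thesis
    using suminf_level_dist_tail_le[of x y "Suc m"] by (simp add: near_dist_def)
qed

lemma same_class_if_near_dist_less:
  assumes "near_dist x y < (1/2) ^ (m + j)"
  shows "same_class m x y"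
proof (rule ccontr)
  assume "\<not> same_class m x y"
  then have "(1/2) ^ (m + j) \<le> level_dist x y m" by (rule level_dist_ge)
  also have "\<dots> \<le> suminf (level_dist x y)"
    using sum_le_suminf[OF level_dist_summable, of "{m}" x y] level_dist_nonneg by simp
  also have "\<dots> \<le> near_dist x y" using grid_dist_nonneg by (simp add: near_dist_def)
  finally show False using assms by simp
qed

sublocale near: Metric_space "topspace X" near_dist
proof
  show "0 \<le> near_dist x y" for x y
    using grid_dist_nonneg suminf_level_dist_nonneg by (simp add: near_dist_def)
  show "near_dist x y = near_dist y x" for x y
    using level_dist_commute[of x y] d.commute by (simp add: near_dist_def grid_dist_def)
  show "near_dist x y = 0 \<longleftrightarrow> x = y" if xy: "x \<in> topspace X" "y \<in> topspace X" for x y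
  proof
    assume "near_dist x y = 0"
    then have "same_class m x y" for m by (intro same_class_if_near_dist_less) auto
    then show "x = y" using exists_p_neq[OF xy] unfolding same_class_def by blast
  next
    assume "x = y"
    then show "near_dist x y = 0"
      using xy p_in by (simp add: near_dist_def grid_dist_def level_dist_def[abs_def] same_class_refl)
  qed
  fix x y z assume xyz: "x \<in> topspace X" "y \<in> topspace X" "z \<in> topspace X"
  have "suminf (level_dist x z) \<le> suminf (\<lambda>m. level_dist x y m + level_dist y z m)"
    by (intro suminf_le level_dist_triangle summable_add level_dist_summable)
  also have "\<dots> = suminf (level_dist x y) + suminf (level_dist y z)"
    by (intro suminf_add[symmetric] level_dist_summable)
  finally show "near_dist x z \<le> near_dist x y + near_dist y z"
    using grid_dist_triangle[OF xyz] by (simp add: near_dist_def)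
qed

text \<open>Classes are open in \<open>X\<close> and lie in small balls of \<open>near_dist\<close>;
  conversely, small balls of \<open>near_dist\<close> lie in classes, whose
  \<open>d'\<close>-diameter tends to 0.\<close>

lemma near_mtopology: "near.mtopology = X"
  unfolding topology_eq
proof (intro allI iffI)
  fix U assume U: "openin near.mtopology U"
  show "openin X U"
  proof (subst openin_subopen, intro ballI)
    fix x assume x: "x \<in> U"
    have xX: "x \<in> topspace X" using U x by (auto simp: near.openin_mtopology)
    obtain r where r: "r > 0" "near.mball x r \<subseteq> U"
      using U x unfolding near.openin_mtopology by blast
    obtain m where m: "2 * (1/2::real) ^ m < r" using exists_small_power[OF r(1)] by blast
    have le: "(1/2::real) ^ (m + j) \<le> (1/2) ^ m" by (intro power_decreasing) auto
    have "{y\<in>topspace X. same_class m x y} \<subseteq> near.mball x r"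
    proof (intro subsetI)
      fix y assume y: "y \<in> {y\<in>topspace X. same_class m x y}"
      then have "near_dist x y \<le> 2 * (1/2) ^ (m + j)"
        using near_dist_le_if_same_class[OF xX] by blast
      with le m have "near_dist x y < r" by linarith
      then show "y \<in> near.mball x r" using xX y by simp
    qed
    then show "\<exists>T. openin X T \<and> x \<in> T \<and> T \<subseteq> U"
      using openin_same_class[OF xX, of m] r(2) xX same_class_refl by blast
  qed
next
  fix U assume "openin X U"
  then have U: "openin d'.mtopology U" by (simp add: d'_mtopology)
  show "openin near.mtopology U"
    unfolding near.openin_mtopology
  proof (intro conjI allI impI)
    show "U \<subseteq> topspace X" using \<open>openin X U\<close> by (rule openin_subset)
    fix x assume x: "x \<in> U"
    have xX: "x \<in> topspace X" using U x by (auto simp: d'.openin_mtopology)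
    obtain r where r: "r > 0" "d'.mball x r \<subseteq> U"
      using U x unfolding d'.openin_mtopology by blast
    obtain m where m: "m > 0" "2 * (1/2::real) ^ m < r" using exists_small_power[OF r(1)] by blast
    have "near.mball x ((1/2) ^ (m + j)) \<subseteq> d'.mball x r"
    proof
      fix y assume "y \<in> near.mball x ((1/2) ^ (m + j))"
      then have y: "y \<in> topspace X" "near_dist x y < (1/2) ^ (m + j)" by auto
      then have "p m x = p m y" using same_class_if_near_dist_less by (auto simp: same_class_def)
      then have "d' x y < r" using d'_less_if_p_eq[OF xX y(1) m(1)] m(2) by simp
      then show "y \<in> d'.mball x r" using xX y by simp
    qed
    then show "\<exists>r>0. near.mball x r \<subseteq> U"
      using r(2) by (intro exI[of _ "(1/2) ^ (m + j)"]) auto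
  qed
qed

lemma near_dist_Met: "near_dist \<in> Met X"
  using near_mtopology near.Metric_space_axioms by (simp add: Met_def)

text \<open>A Cauchy sequence for \<open>near_dist\<close> eventually stays in one class of each
  level, so it is Cauchy for \<open>d'\<close>; convergence depends on the common topology
  only.\<close>

lemma near_mcomplete:
  assumes "d'.mcomplete"
  shows "near.mcomplete"
  unfolding near.mcomplete_def
proof (intro allI impI)
  fix \<sigma> assume \<sigma>: "near.MCauchy \<sigma>"
  have "d'.MCauchy \<sigma>"
    unfolding d'.MCauchy_def
  proof (intro conjI allI impI)
    show range: "range \<sigma> \<subseteq> topspace X" using \<sigma> by (simp add: near.MCauchy_def)
    fix r :: real assume "r > 0"
    then obtain m where m: "m > 0" "2 * (1/2::real) ^ m < r" using exists_small_power by blast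
    obtain N where N: "\<And>n n'. N \<le> n \<Longrightarrow> N \<le> n' \<Longrightarrow> near_dist (\<sigma> n) (\<sigma> n') < (1/2) ^ (m + j)"
      using \<sigma> unfolding near.MCauchy_def by (metis half_gt_zero_iff zero_less_one zero_less_power)
    show "\<exists>N. \<forall>n n'. N \<le> n \<longrightarrow> N \<le> n' \<longrightarrow> d' (\<sigma> n) (\<sigma> n') < r"
    proof (intro exI allI impI)
      fix n n' assume "N \<le> n" "N \<le> n'"
      then have "p m (\<sigma> n) = p m (\<sigma> n')"
        using same_class_if_near_dist_less[OF N, of n n'] unfolding same_class_def by blast
      then show "d' (\<sigma> n) (\<sigma> n') < r"
        using d'_less_if_p_eq[of "\<sigma> n" "\<sigma> n'" m] range m by (auto simp: subset_iff)
    qed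
  qed
  then show "\<exists>x. limitin near.mtopology \<sigma> x sequentially"
    using assms by (simp add: d'.mcomplete_def d'_mtopology near_mtopology)
qed

section \<open>Index sets of the distances and algebraic independence\<close>

definition code_set :: "'a \<Rightarrow> 'a \<Rightarrow> nat set" where
  "code_set x y = pair_code x y ` {m. \<not> same_class m x y}"

lemma inj_pair_code: "inj_on (pair_code x y) A"
  by (auto simp: inj_on_def pair_code_def)

lemma not_same_class_tail:
  assumes "x \<in> topspace X" "y \<in> topspace X" "x \<noteq> y"
  obtains k where "{m. \<not> same_class m x y} = {k..}"
proof -
  obtain n where "\<not> same_class n x y"
    using exists_p_neq[OF assms] unfolding same_class_def by blast
  then have "\<not> same_class (LEAST n. \<not> same_class n x y) x y" by (rule LeastI)
  then have "{m. \<not> same_class m x y} = {(LEAST n. \<not> same_class n x y)..}"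
    using same_class_mono by (auto intro: Least_le)
  then show ?thesis using that by blast
qed

lemma infinite_code_set:
  assumes "x \<in> topspace X" "y \<in> topspace X" "x \<noteq> y"
  shows "infinite (code_set x y)"
proof -
  obtain k where "{m. \<not> same_class m x y} = {k..}" using not_same_class_tail[OF assms] .
  then show ?thesis
    by (simp add: code_set_def finite_image_iff[OF inj_pair_code] infinite_Ici)
qed

text \<open>The main weights over a final segment of levels form a geometric series with rational
  sum and join the grid part; the perturbations form the lacunary series.\<close>

lemma near_dist_eq_lacunary:
  assumes "x \<in> topspace X" "y \<in> topspace X" "x \<noteq> y"
  shows "\<exists>q\<in>\<rat>. near_dist x y = q + suminf (lacunary (code_set x y))"
proof -
  obtain k where k: "{m. \<not> same_class m x y} = {k..}" using not_same_class_tail[OF assms] .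
  define a where "a m = (if m < k then 0 else (1/2::real) ^ (m + j))" for m
  define b where "b m = (if m < k then 0 else liouville_term (pair_code x y m))" for m
  have ab: "level_dist x y m = a m + b m" for m
  proof -
    have "\<not> same_class m x y \<longleftrightarrow> k \<le> m" using k by (metis atLeast_iff mem_Collect_eq)
    then have "same_class m x y \<longleftrightarrow> m < k" by linarith
    then show ?thesis by (simp add: level_dist_def a_def b_def)
  qed
  have a_summable: "summable a"
    by (rule summable_comparison_test'[OF summable_geometric_bound[of j]]) (auto simp: a_def)
  have b_summable: "summable b"
  proof (rule summable_comparison_test'[OF summable_geometric_bound[of j]])
    fix m
    have "\<bar>b m\<bar> \<le> liouville_term (pair_code x y m)"
      using liouville_term_pos[of "pair_code x y m"] by (simp add: b_def)
    moreover have "(0::real) \<le> (1/2) ^ (m + j)" by simp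
    ultimately show "norm (b m) \<le> 2 * (1/2) ^ (m + j)"
      using liouville_term_pair_code_le[of x y m] unfolding real_norm_def by linarith
  qed
  have "suminf a = suminf (\<lambda>l. a (l + k)) + (\<Sum>l<k. a l)"
    by (rule suminf_split_initial_segment[OF a_summable])
  also have "(\<Sum>l<k. a l) = 0" by (simp add: a_def)
  also have "suminf (\<lambda>l. a (l + k)) = suminf (\<lambda>l. (1/2) * (2 * (1/2) ^ (l + (k + j))))"
    by (simp add: a_def add.assoc)
  also have "\<dots> = 2 * (1/2) ^ (k + j)"
    by (subst suminf_mult[OF summable_geometric_bound]) (simp add: suminf_geometric_bound)
  finally have a_sum: "suminf a \<in> \<rat>" by simp
  \<comment> \<open>Passing from levels to codes is a reindexing; unordered summation of nonnegative
    terms avoids asking whether codes increase with the level.\<close>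
  have "(b has_sum suminf b) UNIV"
    using b_summable liouville_term_pos
    by (intro sums_nonneg_imp_has_sum summable_sums) (auto simp: b_def less_imp_le)
  then have "((liouville_term \<circ> pair_code x y) has_sum suminf b) {k..}"
    by (rule has_sum_cong_neutral[THEN iffD1, rotated -1]) (auto simp: b_def)
  then have "(liouville_term has_sum suminf b) (code_set x y)"
    by (simp add: code_set_def k has_sum_reindex[OF inj_pair_code])
  then have "(lacunary (code_set x y) has_sum suminf b) UNIV"
    by (rule has_sum_cong_neutral[THEN iffD1, rotated -1]) (auto simp: lacunary_def)
  then have "suminf (lacunary (code_set x y)) = suminf b"
    by (metis has_sum_imp_sums sums_unique)
  moreover have "suminf (level_dist x y) = suminf a + suminf b"
    unfolding ab[abs_def] by (rule suminf_add[symmetric, OF a_summable b_summable])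
  ultimately have "near_dist x y = (grid_dist x y + suminf a) + suminf (lacunary (code_set x y))"
    by (simp add: near_dist_def)
  moreover have "grid_dist x y + suminf a \<in> \<rat>"
    using a_sum by (simp add: grid_dist_def)
  ultimately show ?thesis by blast
qed

text \<open>Representatives at some level \<open>n\<close> differ, so one bit \<open>i\<close> of
  their images under \<open>f\<close> separates them, and the code contains it once \<open>m\<close>
  reaches \<open>n\<close> and exceeds \<open>i\<close>. Using bits of representatives instead of
  the points themselves keeps the code locally constant.\<close>

lemma eventually_class_code_neq:
  assumes xy: "x \<in> topspace X" "y \<in> topspace X" "x \<noteq> y"
  shows "\<forall>\<^sub>F m in sequentially. class_code m x \<noteq> class_code m y"
proof -
  obtain n where n: "p n x \<noteq> p n y" using exists_p_neq[OF xy] by blast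
  then have "f (p n x) \<noteq> f (p n y)"
    using inj_f p_in[OF xy(1)] p_in[OF xy(2)] by (auto simp: inj_on_def)
  then obtain i where i: "i \<in> f (p n x) \<longleftrightarrow> i \<notin> f (p n y)" by blast
  show ?thesis
    using eventually_ge_at_top[of "max n (Suc i)"]
  proof eventually_elim
    case (elim m)
    show ?case
    proof
      assume "class_code m x = class_code m y"
      then have "\<forall>k\<in>set [0..<Suc m]. set_encode (f (p k x) \<inter> {..<m}) = set_encode (f (p k y) \<inter> {..<m})"
        unfolding class_code_def list_encode_eq map_eq_conv .
      moreover have "n \<in> set [0..<Suc m]" using elim by (simp del: upt_Suc)
      ultimately have "set_encode (f (p n x) \<inter> {..<m}) = set_encode (f (p n y) \<inter> {..<m})"
        by (rule bspec)
      then have "f (p n x) \<inter> {..<m} = f (p n y) \<inter> {..<m}"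
        by (subst (asm) set_encode_eq) auto
      moreover have "i \<in> {..<m}" using elim by simp
      ultimately show False using i by blast
    qed
  qed
qed

text \<open>A code determines its level, so a common code stems from the same level of both pairs.
  From some level on, distinct points among the four have distinct codes, and then the unordered
  pairs of codes differ.\<close>

lemma almost_disjoint_code_sets:
  assumes "{x, y, x', y'} \<subseteq> topspace X" "{x, y} \<noteq> {x', y'}"
  shows "finite (code_set x y \<inter> code_set x' y')"
proof -
  let ?F = "{x, y, x', y'}"
  have "\<forall>\<^sub>F m in sequentially. \<forall>u\<in>?F. \<forall>v\<in>?F. u \<noteq> v \<longrightarrow> class_code m u \<noteq> class_code m v"
  proof (intro eventually_ball_finite ballI)
    fix u v assume "u \<in> ?F" "v \<in> ?F"
    then show "\<forall>\<^sub>F m in sequentially. u \<noteq> v \<longrightarrow> class_code m u \<noteq> class_code m v"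
      using assms(1) eventually_class_code_neq[of u v] by (cases "u = v") auto
  qed auto
  then obtain k where "\<forall>m\<ge>k. \<forall>u\<in>?F. \<forall>v\<in>?F. u \<noteq> v \<longrightarrow> class_code m u \<noteq> class_code m v"
    unfolding eventually_sequentially by blast
  then have inj: "inj_on (class_code m) ?F" if "m \<ge> k" for m
    using that unfolding inj_on_def by blast
  have neq: "pair_code x y m \<noteq> pair_code x' y' m" if "m \<ge> k" for m
  proof -
    have "class_code m ` {x, y} \<noteq> class_code m ` {x', y'}"
      using assms(2) inj_on_image_eq_iff[OF inj[OF that], of "{x, y}" "{x', y'}"] by blast
    then show ?thesis by (simp add: pair_code_def set_encode_eq)
  qed
  have "code_set x y \<inter> code_set x' y' \<subseteq> pair_code x y ` {..<k}"
  proof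
    fix n assume "n \<in> code_set x y \<inter> code_set x' y'"
    then obtain m m' where m: "n = pair_code x y m" "n = pair_code x' y' m'"
      unfolding code_set_def by blast
    then have "m = m'" by (auto simp: pair_code_def)
    then have "m < k" using neq m by (metis not_le)
    then show "n \<in> pair_code x y ` {..<k}" using m by blast
  qed
  then show ?thesis by (rule finite_subset) auto
qed

lemma alg_indep_near_dist: "alg_indep_distances X near_dist"
  unfolding alg_indep_distances_def
proof (intro allI impI)
  fix r and x y :: "nat \<Rightarrow> 'a" and P
  assume xy: "\<forall>i<r. x i \<in> topspace X \<and> y i \<in> topspace X \<and> x i \<noteq> y i"
    and inj: "inj_on (\<lambda>i. {x i, y i}) {..<r}" and P: "P \<in> rat_mpolys r" "P \<noteq> 0"
  define S where "S i = code_set (x i) (y i)" for i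
  have "\<forall>i. \<exists>q. i < r \<longrightarrow> q \<in> \<rat> \<and> near_dist (x i) (y i) = q + suminf (lacunary (S i))"
    using near_dist_eq_lacunary xy unfolding S_def by blast
  then obtain q where q: "\<And>i. i < r \<Longrightarrow> q i \<in> \<rat>"
    "\<And>i. i < r \<Longrightarrow> near_dist (x i) (y i) = q i + suminf (lacunary (S i))" by metis
  have "eval_mpoly r P (\<lambda>i. q i + suminf (lacunary (S i))) \<noteq> 0"
  proof (rule lacunary_algebraically_independent[OF _ _ q(1) P])
    show "infinite (S i)" if "i < r" for i
      unfolding S_def using xy that by (intro infinite_code_set) auto
    show "finite (S i \<inter> S k)" if "i < r" "k < r" "i \<noteq> k" for i k
      unfolding S_def
    proof (rule almost_disjoint_code_sets)
      show "{x i, y i, x k, y k} \<subseteq> topspace X" using xy that by blast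
      show "{x i, y i} \<noteq> {x k, y k}" using inj_onD[OF inj, of i k] that by auto
    qed
  qed
  moreover have "eval_mpoly r P (\<lambda>i. near_dist (x i) (y i)) =
      eval_mpoly r P (\<lambda>i. q i + suminf (lacunary (S i)))"
    unfolding eval_mpoly_def using q(2) by (intro sum.cong prod.cong arg_cong2[where f = "(*)"] refl) simp
  ultimately show "eval_mpoly r P (\<lambda>i. near_dist (x i) (y i)) \<noteq> 0" by simp
qed

lemma sup_dist_near_dist: "sup_dist X d near_dist \<le> ennreal (7 * (1/2) ^ j)"
  unfolding sup_dist_def using near_dist_approx
  by (auto intro!: SUP_least ennreal_leI)

end

section \<open>Choice of the partitions and of the accuracy\<close>

lemma exists_near_alg_indep_metric:
  fixes X :: "'a topology" and \<epsilon> :: real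
  assumes X: "strongly_zero_dimensional X" "topspace X \<lesssim> (UNIV :: real set)"
    and d: "d \<in> Met X" and d': "d' \<in> Met X" and "\<epsilon> > 0"
  obtains e where "e \<in> AMet X" "sup_dist X d e < ennreal \<epsilon>"
    "Metric_space.mcomplete (topspace X) d' \<Longrightarrow> Metric_space.mcomplete (topspace X) e"
proof -
  \<comment> \<open>7 is the constant of \<open>near_dist_approx\<close>.\<close>
  obtain j where j: "(1/2::real) ^ j < \<epsilon> / 7"
    using real_arch_pow_inv[of "\<epsilon> / 7" "1/2"] \<open>\<epsilon> > 0\<close> by auto
  have part: "\<exists>p. (\<forall>x\<in>topspace X. p x \<in> topspace X \<and> \<rho> x (p x) < \<eta> \<and>
      openin X {y\<in>topspace X. p y = p x})" if "\<rho> \<in> Met X" "\<eta> > 0" for \<rho> :: "'a \<Rightarrow> 'a \<Rightarrow> real" and \<eta>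
  proof -
    interpret Metric_space "topspace X" \<rho> using that by (simp add: Met_def)
    have top: "mtopology = X" using that by (simp add: Met_def)
    show ?thesis
      using clopen_partition[unfolded top, OF X(1) that(2)] by metis
  qed
  have "\<exists>p. \<forall>x\<in>topspace X. p x \<in> topspace X \<and> openin X {y\<in>topspace X. p y = p x} \<and>
      (n = 0 \<longrightarrow> d x (p x) < (1/2) ^ j) \<and> (n > 0 \<longrightarrow> d' x (p x) < (1/2) ^ n)" for n :: nat
    using part[OF d, of "(1/2) ^ j"] part[OF d', of "(1/2) ^ n"] by (cases "n = 0") auto
  then have "\<exists>p. \<forall>n. \<forall>x\<in>topspace X. p n x \<in> topspace X \<and>
      openin X {y\<in>topspace X. p n y = p n x} \<and>
      (n = 0 \<longrightarrow> d x (p n x) < (1/2) ^ j) \<and> (n > 0 \<longrightarrow> d' x (p n x) < (1/2) ^ n)"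
    by (intro choice allI)
  then obtain p where p: "\<And>n x. x \<in> topspace X \<Longrightarrow> p n x \<in> topspace X \<and>
      openin X {y\<in>topspace X. p n y = p n x} \<and>
      (n = 0 \<longrightarrow> d x (p n x) < (1/2) ^ j) \<and> (n > 0 \<longrightarrow> d' x (p n x) < (1/2) ^ n)"
    by blast
  have "topspace X \<lesssim> (UNIV :: nat set set)"
    using X(2) nat_sets_eqpoll_reals by (meson eqpoll_imp_lepoll eqpoll_sym lepoll_trans)
  then obtain f :: "'a \<Rightarrow> nat set" where f: "inj_on f (topspace X)" by (auto simp: lepoll_def)
  interpret near_metric_data X d d' p j f
    using d d' p f by unfold_locales auto
  show ?thesis
  proof
    show "near_dist \<in> AMet X" using near_dist_Met alg_indep_near_dist by (simp add: AMet_def)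
    have "ennreal (7 * (1/2) ^ j) < ennreal \<epsilon>" using j \<open>\<epsilon> > 0\<close> by (intro ennreal_lessI) auto
    with sup_dist_near_dist show "sup_dist X d near_dist < ennreal \<epsilon>" by (rule le_less_trans)
  qed (rule near_mcomplete)
qed

theorem theorem1p2:
  fixes X :: "'a topology"
  assumes "metrizable_space X"
    and "strongly_zero_dimensional X"
    and "topspace X \<lesssim> (UNIV :: real set)"
  shows "(\<forall>d\<in>Met X. \<forall>\<epsilon>::real. \<epsilon> > 0 \<longrightarrow>
            (\<exists>e\<in>AMet X. sup_dist X d e < ennreal \<epsilon>)) \<and>
         (completely_metrizable_space X \<longrightarrow>
            (\<forall>d\<in>Met X. \<forall>\<epsilon>::real. \<epsilon> > 0 \<longrightarrow>
              (\<exists>e\<in>AMet X. Metric_space.mcomplete (topspace X) e \<and>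
                 sup_dist X d e < ennreal \<epsilon>)))"
proof (intro conjI ballI allI impI)
  fix d and \<epsilon> :: real assume "d \<in> Met X" "\<epsilon> > 0"
  then show "\<exists>e\<in>AMet X. sup_dist X d e < ennreal \<epsilon>"
    \<comment> \<open>Without a completeness claim, \<open>d\<close> itself serves as
      \<open>d'\<close>.\<close>
    using exists_near_alg_indep_metric[OF assms(2,3)] by metis
next
  fix d and \<epsilon> :: real assume "completely_metrizable_space X" and d: "d \<in> Met X" "\<epsilon> > 0"
  then obtain M d' where "Metric_space M d'" "Metric_space.mcomplete M d'"
    "X = Metric_space.mtopology M d'" by (auto simp: completely_metrizable_space_def)
  moreover from this have "topspace X = M" by (simp add: Metric_space.topspace_mtopology)
  ultimately have "d' \<in> Met X" "Metric_space.mcomplete (topspace X) d'" by (auto simp: Met_def)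
  then show "\<exists>e\<in>AMet X. Metric_space.mcomplete (topspace X) e \<and> sup_dist X d e < ennreal \<epsilon>"
    using exists_near_alg_indep_metric[OF assms(2,3) d(1) _ d(2)] by metis
qed

end
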